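(* The ratio $\frac{\mathrm{edim}(G)}{\dim(G)}$ is not bounded from above over simple connected graphs $G$: for every real number $C$ there exists a simple connected graph $G$ with $\frac{\mathrm{edim}(G)}{\dim(G)}>C$.
   Context: All graphs are simple, connected and undirected; $d$ denotes shortest-path distance. A vertex $v$ distinguishes vertices $v_1,v_2$ if $d(v,v_1)\neq d(v,v_2)$; a set $S\subseteq V$ is a vertex generating set if every pair of distinct vertices is distinguished by some vertex of $S$; the metric dimension $\dim(G)$ is the minimum size of a vertex generating set. For an edge $e=xy$ and a vertex $v$, $d(e,v)=\min\{d(x,v),d(y,v)\}$; $v$ distinguishes edges $e_1,e_2$ if $d(e_1,v)\neq d(e_2,v)$; a set $S\subseteq V$ is an edge metric generator if every pair of distinct edges is distinguished by some vertex of $S$; the edge dimension $\mathrm{edim}(G)$ is the minimum size of an edge metric generator. *)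

theory Defs
  imports "Graph_Theory.Graph_Theory"
begin

(* With unit weights the cost of a walk is its number of edges. *)
definition gdist :: "('a, 'b) pre_digraph \<Rightarrow> 'a \<Rightarrow> 'a \<Rightarrow> ereal" where
  "gdist G u v = wf_digraph.\<mu> G (\<lambda>_. 1) u v"

(* A symmetric digraph has two arcs for each undirected edge xy; passing to {x, y}
   identifies them. *)
definition uedges :: "('a, 'b) pre_digraph \<Rightarrow> 'a set set" where
  "uedges G = {{x, y} | x y. x \<rightarrow>\<^bsub>G\<^esub> y}"

definition edge_dist :: "('a, 'b) pre_digraph \<Rightarrow> 'a set \<Rightarrow> 'a \<Rightarrow> ereal" where
  "edge_dist G e v = Min ((\<lambda>x. gdist G x v) ` e)"

definition distinguishes_verts :: "('a, 'b) pre_digraph \<Rightarrow> 'a \<Rightarrow> 'a \<Rightarrow> 'a \<Rightarrow> bool" where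
  "distinguishes_verts G v v1 v2 \<longleftrightarrow> gdist G v v1 \<noteq> gdist G v v2"

definition distinguishes_edges :: "('a, 'b) pre_digraph \<Rightarrow> 'a \<Rightarrow> 'a set \<Rightarrow> 'a set \<Rightarrow> bool" where
  "distinguishes_edges G v e1 e2 \<longleftrightarrow> edge_dist G e1 v \<noteq> edge_dist G e2 v"

definition vertex_generating_set :: "('a, 'b) pre_digraph \<Rightarrow> 'a set \<Rightarrow> bool" where
  "vertex_generating_set G S \<longleftrightarrow> S \<subseteq> verts G \<and>
     (\<forall>v1\<in>verts G. \<forall>v2\<in>verts G. v1 \<noteq> v2 \<longrightarrow> (\<exists>v\<in>S. distinguishes_verts G v v1 v2))"

definition edge_metric_generator :: "('a, 'b) pre_digraph \<Rightarrow> 'a set \<Rightarrow> bool" where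
  "edge_metric_generator G S \<longleftrightarrow> S \<subseteq> verts G \<and>
     (\<forall>e1\<in>uedges G. \<forall>e2\<in>uedges G. e1 \<noteq> e2 \<longrightarrow> (\<exists>v\<in>S. distinguishes_edges G v e1 e2))"

(* Meaningful for finite graphs, where every subset of the vertices is finite. *)
definition metric_dim :: "('a, 'b) pre_digraph \<Rightarrow> nat" where
  "metric_dim G = (LEAST k. \<exists>S. vertex_generating_set G S \<and> card S = k)"

definition edge_dim :: "('a, 'b) pre_digraph \<Rightarrow> nat" where
  "edge_dim G = (LEAST k. \<exists>S. edge_metric_generator G S \<and> card S = k)"

end

theory Submission
  imports Defs "HOL-Real_Asymp.Real_Asymp"
begin

text \<open>
  In a graph with a universal vertex u, an edge ux has distance 1 from every vertex
  outside {u, x}, so two edges ux and uy are told apart only by x and y; hence all but at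
  most one of the vertices other than u belong to each edge metric generator. For vertices,
  on the other hand, k binary coordinates separate \<open>2 ^ k\<close> points: make each number below
  \<open>2 ^ k\<close> adjacent to the coordinate vertices given by its binary digits, and add a universal
  vertex. The edge dimension is then at least \<open>2 ^ k\<close>, the metric dimension at most k + 1.
\<close>

section \<open>Distances and vertex generating sets\<close>

context wf_digraph
begin

lemma gdist_leI:
  assumes "awalk u p v"
  shows "gdist G u v \<le> ereal (real (length p))"
proof -
  have "awalk_cost (\<lambda>_. 1) p = real (length p)" by (induction p) auto
  with min_cost_le_walk_cost[OF assms, of "\<lambda>_. 1"] show ?thesis
    by (simp add: gdist_def)
qed

text \<open>The distance is an infimum over walks, so a bound valid for every walk passes to it; if
  there is no walk it is infinite and the bound still holds.\<close>

lemma gdist_geI: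
  assumes "\<And>p. awalk u p v \<Longrightarrow> n \<le> length p"
  shows "ereal (real n) \<le> gdist G u v"
proof -
  have "awalk_cost (\<lambda>_. 1) p = real (length p)" for p by (induction p) auto
  with assms show ?thesis
    by (auto simp: gdist_def \<mu>_def intro!: INF_greatest)
qed

lemma gdist_nonneg: "0 \<le> gdist G u v"
  using gdist_geI[of u v 0] by (simp add: zero_ereal_def)

lemma gdist_self: "u \<in> verts G \<Longrightarrow> gdist G u u = 0"
  using gdist_leI[of u "[]" u] gdist_nonneg[of u u]
  by (simp add: awalk_Nil_iff zero_ereal_def antisym)

lemma gdist_ge_1: "u \<noteq> v \<Longrightarrow> 1 \<le> gdist G u v"
proof -
  assume "u \<noteq> v"
  then have "1 \<le> length p" if "awalk u p v" for p
    using that by (cases p) (auto simp: awalk_simps)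
  then show ?thesis using gdist_geI[of u v 1] by (simp add: one_ereal_def)
qed

text \<open>Loops are allowed in this locale, and a vertex has distance 0 from itself even if it
  carries one; hence \<open>u\<close> and \<open>v\<close> are taken distinct.\<close>

lemma gdist_eq_1_iff:
  assumes "u \<noteq> v"
  shows "gdist G u v = 1 \<longleftrightarrow> u \<rightarrow>\<^bsub>G\<^esub> v"
proof
  assume "u \<rightarrow>\<^bsub>G\<^esub> v"
  then obtain e where "e \<in> arcs G" "tail G e = u" "head G e = v" by auto
  then have "awalk u [e] v" by (auto simp: awalk_simps)
  from gdist_leI[OF this] gdist_ge_1[OF assms] show "gdist G u v = 1"
    by (simp add: one_ereal_def antisym)
next
  assume 1: "gdist G u v = 1"
  show "u \<rightarrow>\<^bsub>G\<^esub> v"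
  proof (rule ccontr)
    assume *: "\<not> u \<rightarrow>\<^bsub>G\<^esub> v"
    \<comment> \<open>An empty walk would force \<open>u = v\<close>, a walk with one arc would make
      the vertices adjacent.\<close>
    have "2 \<le> length p" if p: "awalk u p v" for p
    proof (rule ccontr)
      assume "\<not> 2 \<le> length p"
      then consider "p = []" | e where "p = [e]"
        by (cases p; cases "tl p") auto
      then show False
        using p assms * by cases (auto simp: awalk_simps arcs_ends_conv)
    qed
    from gdist_geI[of u v 2, OF this] 1 show False by (simp add: one_ereal_def)
  qed
qed

lemma metric_dim_le:
  "vertex_generating_set G S \<Longrightarrow> metric_dim G \<le> card S"
  unfolding metric_dim_def by (rule Least_le) auto

text \<open>A vertex of \<open>S\<close> is the only one at distance 0 from itself, so only pairs
  outside \<open>S\<close> matter. For these, adjacency to \<open>v\<close> says whether the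
  distance is 1, and no longer distances have to be computed.\<close>

lemma vertex_generating_set_if_arcs_differ:
  assumes "S \<subseteq> verts G"
    and "\<And>x y. \<lbrakk>x \<in> verts G - S; y \<in> verts G - S; x \<noteq> y\<rbrakk>
      \<Longrightarrow> \<exists>v\<in>S. \<not> (v \<rightarrow>\<^bsub>G\<^esub> x \<longleftrightarrow> v \<rightarrow>\<^bsub>G\<^esub> y)"
  shows "vertex_generating_set G S"
  unfolding vertex_generating_set_def
proof (intro conjI ballI impI)
  have self: "distinguishes_verts G x x y" "distinguishes_verts G x y x"
    if "x \<in> S" "x \<noteq> y" for x y
    using that assms(1) gdist_self[of x] gdist_ge_1[of x y]
    by (auto simp: distinguishes_verts_def)
  fix x y assume xy: "x \<in> verts G" "y \<in> verts G" "x \<noteq> y"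
  show "\<exists>v\<in>S. distinguishes_verts G v x y"
  proof (cases "x \<in> S \<or> y \<in> S")
    case True
    with self(1)[of x y] self(2)[of y x] xy(3) show ?thesis by blast
  next
    case False
    with assms(2)[of x y] xy obtain v where v: "v \<in> S" "\<not> (v \<rightarrow>\<^bsub>G\<^esub> x \<longleftrightarrow> v \<rightarrow>\<^bsub>G\<^esub> y)"
      by auto
    with False have "v \<noteq> x" "v \<noteq> y" by auto
    then have "distinguishes_verts G v x y"
      using v(2) gdist_eq_1_iff[of v x] gdist_eq_1_iff[of v y]
      by (auto simp: distinguishes_verts_def)
    with v(1) show ?thesis by blast
  qed
qed (fact assms(1))

end

text \<open>The empty set cannot separate two vertices. The set of all vertices is generating, so
  the minimum is attained, and it is attained by a finite set, whose cardinality is 0 only if it is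
  empty.\<close>

lemma (in fin_digraph) metric_dim_pos:
  assumes "x \<in> verts G" "y \<in> verts G" "x \<noteq> y"
  shows "0 < metric_dim G"
proof -
  have "vertex_generating_set G (verts G)"
    by (rule vertex_generating_set_if_arcs_differ) auto
  then have "\<exists>k S. vertex_generating_set G S \<and> card S = k" by blast
  then have "\<exists>S. vertex_generating_set G S \<and> card S = metric_dim G"
    unfolding metric_dim_def by (rule LeastI_ex)
  then obtain S where S: "vertex_generating_set G S" "card S = metric_dim G" by blast
  then have "finite S" "S \<noteq> {}"
    using assms finite_verts
    by (auto simp: vertex_generating_set_def dest: finite_subset)
  with S(2) show ?thesis by (metis card_gt_0_iff)
qed

section \<open>Edge metric generators and universal vertices\<close>

context digraph
begin

lemma uedgesE:
  assumes "e \<in> uedges G"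
  obtains x y where "e = {x, y}" "x \<in> verts G" "y \<in> verts G"
proof -
  from assms obtain x y where "e = {x, y}" "x \<rightarrow>\<^bsub>G\<^esub> y"
    unfolding uedges_def by blast
  with adj_in_verts[of x y] show thesis using that by simp
qed

lemma edge_dist_pair: "edge_dist G {x, y} v = min (gdist G x v) (gdist G y v)"
  by (simp add: edge_dist_def)

lemma edge_dist_eq_0_iff:
  assumes "e \<in> uedges G" "v \<in> verts G"
  shows "edge_dist G e v = 0 \<longleftrightarrow> v \<in> e"
proof -
  obtain x y where e: "e = {x, y}" using assms(1) by (rule uedgesE)
  have *: "gdist G z v = 0 \<longleftrightarrow> z = v" for z
  proof
    assume "gdist G z v = 0"
    then have "\<not> 1 \<le> gdist G z v" by simp
    with gdist_ge_1[of z v] show "z = v" by blast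
  qed (use gdist_self[OF assms(2)] in simp)
  have min0: "min a b = 0 \<longleftrightarrow> a = 0 \<or> b = 0" if "0 \<le> a" "0 \<le> b" for a b :: ereal
    using that by (auto simp: min_def)
  have "edge_dist G e v = 0 \<longleftrightarrow> x = v \<or> y = v"
    unfolding e edge_dist_pair min0[OF gdist_nonneg gdist_nonneg] * ..
  then show ?thesis by (auto simp: e)
qed

text \<open>This guarantees that the minimum in \<open>edge_dim\<close> is attained. Distinct edges
  differ in an endpoint, which has distance 0 from exactly one of them.\<close>

lemma edge_metric_generator_verts: "edge_metric_generator G (verts G)"
  unfolding edge_metric_generator_def
proof (intro conjI ballI impI)
  fix e f assume ef: "e \<in> uedges G" "f \<in> uedges G" "e \<noteq> f"
  then have "e \<subseteq> verts G" "f \<subseteq> verts G" by (auto elim!: uedgesE)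
  with ef(3) obtain v where v: "v \<in> verts G" "\<not> (v \<in> e \<longleftrightarrow> v \<in> f)" by blast
  have "distinguishes_edges G v e f"
    using v edge_dist_eq_0_iff[OF ef(1) v(1)] edge_dist_eq_0_iff[OF ef(2) v(1)]
    by (auto simp: distinguishes_edges_def)
  with v(1) show "\<exists>v\<in>verts G. distinguishes_edges G v e f" by blast
qed simp

text \<open>The summand 2 accounts for \<open>u\<close> and for the single further vertex that
  \<open>S\<close> may miss.\<close>

lemma card_edge_metric_generator_ge:
  assumes "edge_metric_generator G S"
    and u: "u \<in> verts G" "\<And>x. x \<in> verts G \<Longrightarrow> x \<noteq> u \<Longrightarrow> u \<rightarrow>\<^bsub>G\<^esub> x"
  shows "card (verts G) \<le> card S + 2"
proof -
  let ?R = "verts G - {u} - S"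
  have S: "S \<subseteq> verts G" "finite S"
    using assms(1) finite_verts
    by (auto simp: edge_metric_generator_def dest: finite_subset)
  have "x = y" if xy: "x \<in> ?R" "y \<in> ?R" for x y
  proof (rule ccontr)
    assume "x \<noteq> y"
    have "u \<rightarrow>\<^bsub>G\<^esub> x" "u \<rightarrow>\<^bsub>G\<^esub> y" using u(2) xy by simp_all
    then have e: "{u, x} \<in> uedges G" "{u, y} \<in> uedges G"
      unfolding uedges_def by blast+
    have ne: "{u, x} \<noteq> {u, y}" using \<open>x \<noteq> y\<close> by (simp add: doubleton_eq_iff)
    have "\<forall>e1\<in>uedges G. \<forall>e2\<in>uedges G. e1 \<noteq> e2 \<longrightarrow>
        (\<exists>v\<in>S. edge_dist G e1 v \<noteq> edge_dist G e2 v)"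
      using assms(1) unfolding edge_metric_generator_def distinguishes_edges_def by (rule conjunct2)
    from this[THEN bspec, OF e(1), THEN bspec, OF e(2), THEN mp, OF ne]
    obtain v where v: "v \<in> S" "edge_dist G {u, x} v \<noteq> edge_dist G {u, y} v" ..
    \<comment> \<open>As \<open>z\<close> is not in \<open>S\<close>, it differs from
      \<open>v\<close> and is never closer to \<open>v\<close> than \<open>u\<close> is. Seen from
      \<open>S\<close>, all edges \<open>{u, z}\<close> therefore look alike.\<close>
    have "edge_dist G {u, z} v = gdist G u v" if "z \<in> ?R" for z
    proof (cases "v = u")
      case True
      with gdist_self[OF u(1)] gdist_nonneg[of z u] show ?thesis
        by (simp add: edge_dist_pair min_def)
    next
      case False
      with u(2)[of v] v(1) S(1) have "u \<rightarrow>\<^bsub>G\<^esub> v" by blast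
      with False have "gdist G u v = 1" using gdist_eq_1_iff[of u v] by simp
      moreover have "1 \<le> gdist G z v" using that v(1) by (intro gdist_ge_1) auto
      ultimately show ?thesis by (simp add: edge_dist_pair min_def)
    qed
    from this[OF xy(1)] this[OF xy(2)] v(2) show False by simp
  qed
  then have "\<forall>x\<in>?R. \<forall>y\<in>?R. x = y" by blast
  moreover have "finite ?R" using finite_verts by blast
  ultimately have "card ?R \<le> Suc 0" by (rule card_le_Suc0_iff_eq[THEN iffD2, rotated])
  moreover have "verts G \<subseteq> insert u (S \<union> ?R)" by auto
  then have "card (verts G) \<le> card (insert u (S \<union> ?R))"
    using S(2) finite_verts by (intro card_mono) auto
  moreover have "\<dots> \<le> Suc (card (S \<union> ?R))"
    using S(2) finite_verts by (simp add: card_insert_if)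
  moreover have "card (S \<union> ?R) \<le> card S + card ?R" by (rule card_Un_le)
  ultimately show ?thesis by linarith
qed

lemma edge_dim_ge:
  assumes "u \<in> verts G" "\<And>x. x \<in> verts G \<Longrightarrow> x \<noteq> u \<Longrightarrow> u \<rightarrow>\<^bsub>G\<^esub> x"
  shows "card (verts G) \<le> edge_dim G + 2"
proof -
  have "\<exists>k S. edge_metric_generator G S \<and> card S = k"
    using edge_metric_generator_verts by blast
  then have "\<exists>S. edge_metric_generator G S \<and> card S = edge_dim G"
    unfolding edge_dim_def by (rule LeastI_ex)
  then obtain S where "edge_metric_generator G S" "card S = edge_dim G" by blast
  with card_edge_metric_generator_ge[OF _ assms] show ?thesis by fastforce
qed

end

section \<open>The graph of binary words\<close>

text \<open>
  The vertices below \<open>2 ^ k\<close> are the binary words, \<open>2 ^ k + i\<close> with \<open>i < k\<close> is the i-th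
  coordinate vertex and \<open>2 ^ k + k\<close> is the universal vertex.
\<close>

definition bit_adj :: "nat \<Rightarrow> nat \<Rightarrow> nat \<Rightarrow> bool" where
  "bit_adj k x y \<longleftrightarrow> x < y \<and> (y = 2 ^ k + k \<or> (\<exists>i<k. y = 2 ^ k + i \<and> x < 2 ^ k \<and> bit x i))"

definition bit_graph :: "nat \<Rightarrow> nat pair_pre_digraph" where
  "bit_graph k = \<lparr>pverts = {..2 ^ k + k},
     parcs = {(x, y). x \<le> 2 ^ k + k \<and> y \<le> 2 ^ k + k \<and> (bit_adj k x y \<or> bit_adj k y x)}\<rparr>"

lemma bit_graph_simps [simp]:
  "pverts (bit_graph k) = {..2 ^ k + k}"
  "(x, y) \<in> parcs (bit_graph k) \<longleftrightarrow>
    x \<le> 2 ^ k + k \<and> y \<le> 2 ^ k + k \<and> (bit_adj k x y \<or> bit_adj k y x)"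
  by (simp_all add: bit_graph_def)

text \<open>The strict inequality in \<open>bit_adj\<close> excludes loops; symmetry is built into
  \<open>parcs\<close>.\<close>

lemma pair_graph_bit_graph: "pair_graph (bit_graph k)"
proof
  have "parcs (bit_graph k) \<subseteq> {..2 ^ k + k} \<times> {..2 ^ k + k}" by auto
  then show "finite (parcs (bit_graph k))" by (rule finite_subset) simp
  show "symmetric (with_proj (bit_graph k))"
    by (auto simp: symmetric_def sym_def)
qed (auto simp: bit_adj_def)

lemma bit_graph_universal:
  "x \<le> 2 ^ k + k \<Longrightarrow> x \<noteq> 2 ^ k + k \<Longrightarrow> (2 ^ k + k, x) \<in> parcs (bit_graph k)"
  by (simp add: bit_adj_def)

lemma connected_bit_graph: "connected (with_proj (bit_graph k))"
proof -
  interpret pair_graph "bit_graph k" by (rule pair_graph_bit_graph)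
  let ?u = "2 ^ k + k :: nat"
  have "?u \<rightarrow>\<^sup>*\<^bsub>bit_graph k\<^esub> x" if "x \<le> ?u" for x
    using that bit_graph_universal[of x k] by (cases "x = ?u") auto
  moreover have "x \<rightarrow>\<^sup>*\<^bsub>bit_graph k\<^esub> ?u" if "x \<le> ?u" for x
    using that bit_graph_universal[of x k] arcs_symmetric[of ?u x] by (cases "x = ?u") auto
  ultimately have "x \<rightarrow>\<^sup>*\<^bsub>bit_graph k\<^esub> y" if "x \<le> ?u" "y \<le> ?u" for x y
    using that reachable_trans by blast
  then show ?thesis
    by (intro connectedI reachable_mk_symmetricI) auto
qed

lemma metric_dim_bit_graph_le: "metric_dim (with_proj (bit_graph k)) \<le> k + 1"
proof -
  interpret pair_graph "bit_graph k" by (rule pair_graph_bit_graph)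
  \<comment> \<open>These are the k coordinate vertices and the universal vertex, so that only
    binary words remain outside.\<close>
  let ?S = "{2 ^ k..2 ^ k + k}"
  have "vertex_generating_set (with_proj (bit_graph k)) ?S"
  proof (rule wf_digraph.vertex_generating_set_if_arcs_differ[OF wf_digraph])
    fix x y assume "x \<in> verts (with_proj (bit_graph k)) - ?S"
      "y \<in> verts (with_proj (bit_graph k)) - ?S" "x \<noteq> y"
    then have xy: "x < 2 ^ k" "y < 2 ^ k" "x \<noteq> y" by auto
    from \<open>x \<noteq> y\<close> obtain i where i: "bit x i \<noteq> bit y i" by (auto simp: bit_eq_iff)
    \<comment> \<open>A number below \<open>2 ^ k\<close> has no binary digit 1 at position k or
      beyond.\<close>
    with xy have "i < k" by (metis bit_take_bit_iff take_bit_nat_eq_self)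
    have "(2 ^ k + i) \<rightarrow>\<^bsub>bit_graph k\<^esub> z \<longleftrightarrow> bit z i" if "z < 2 ^ k" for z
      using that \<open>i < k\<close> by (auto simp: bit_adj_def)
    with xy i \<open>i < k\<close>
    show "\<exists>v\<in>?S. \<not> (v \<rightarrow>\<^bsub>bit_graph k\<^esub> x \<longleftrightarrow> v \<rightarrow>\<^bsub>bit_graph k\<^esub> y)"
      by (intro bexI[of _ "2 ^ k + i"]) auto
  qed auto
  from metric_dim_le[OF this] show ?thesis by simp
qed

theorem theorem3p1:
  "\<forall>C::real. \<exists>G :: nat pair_pre_digraph. pair_graph G \<and> connected (with_proj G) \<and>
     real (edge_dim (with_proj G)) / real (metric_dim (with_proj G)) > C"
proof
  fix C :: real
  \<comment> \<open>This quotient will bound the ratio of the dimensions from below.\<close>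
  have "filterlim (\<lambda>k::nat. 2 ^ k / (real k + 1)) at_top at_top" by real_asymp
  then have "eventually (\<lambda>k::nat. C < 2 ^ k / (real k + 1)) at_top"
    by (simp add: filterlim_at_top_dense)
  then have "eventually (\<lambda>k::nat. 1 \<le> k \<and> C < 2 ^ k / (real k + 1)) at_top"
    by (intro eventually_conj eventually_ge_at_top)
  then obtain k :: nat where k: "1 \<le> k" "C < 2 ^ k / (real k + 1)"
    by (auto simp: eventually_at_top_linorder)
  let ?G = "with_proj (bit_graph k)"
  interpret pair_graph "bit_graph k" by (rule pair_graph_bit_graph)
  have "card (pverts (bit_graph k)) \<le> edge_dim ?G + 2"
    by (rule edge_dim_ge[of "2 ^ k + k"]) (use bit_graph_universal in auto)
  \<comment> \<open>There are \<open>2 ^ k + k + 1\<close> vertices, so the loss of 2 is absorbed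
    once k is at least 1.\<close>
  with k(1) have "2 ^ k \<le> edge_dim ?G" by simp
  then have "2 ^ k \<le> real (edge_dim ?G)"
    by (metis of_nat_le_iff of_nat_numeral of_nat_power)
  moreover have "real (metric_dim ?G) \<le> real k + 1"
    using metric_dim_bit_graph_le[of k] by linarith
  \<comment> \<open>Division by 0 yields 0, so the comparison of fractions relies on a positive
    denominator.\<close>
  moreover have "0 < metric_dim ?G"
    by (rule metric_dim_pos[of 0 1]) (use k(1) in auto)
  ultimately have "2 ^ k / (real k + 1) \<le> real (edge_dim ?G) / real (metric_dim ?G)"
    by (intro frac_le) auto
  with k(2) have "C < real (edge_dim ?G) / real (metric_dim ?G)" by linarith
  with pair_graph_bit_graph connected_bit_graph
  show "\<exists>G :: nat pair_pre_digraph. pair_graph G \<and> connected (with_proj G) \<and>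
     real (edge_dim (with_proj G)) / real (metric_dim (with_proj G)) > C"
    by blast
qed

end
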